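(* Let $n\ge 2$ and let $f\in\mathcal S_r(\mathbb R^{n-1}\times\mathbb R^{n-1})$. Then for all $(\boldsymbol\xi,\mathbf v)\in\mathbb R^{n-1}\times\mathbb R^{n-1}$, $$\mathcal F_1(Cf)(\boldsymbol\xi,\mathbf v)=\mathcal F f(\boldsymbol\xi,|\mathbf v|\boldsymbol\xi)=\mathcal F f(\boldsymbol\xi,\mathbf v|\boldsymbol\xi|).$$
   Context: $\mathcal S_r(\mathbb R^{n-1}\times\mathbb R^{n-1})$ is the set of Schwartz functions $f\in\mathcal S(\mathbb R^{2(n-1)})$ with $f(\mathbf x,\mathbf y)=f(\mathbf x,U\mathbf y)$ for all $(\mathbf x,\mathbf y)\in\mathbb R^{n-1}\times\mathbb R^{n-1}$ and all orthogonal transformations $U$ of $\mathbb R^{n-1}$. The cone transform of $f$ is $$Cf(\mathbf u,\mathbf v)=\int_{\mathbb R^{n-1}}f(\mathbf u+|\mathbf v|\mathbf y,\mathbf y)\,d\mathbf y,\qquad(\mathbf u,\mathbf v)\in\mathbb R^{n-1}\times\mathbb R^{n-1}.$$ $\mathcal F_1$ denotes the $(n-1)$-dimensional Fourier transform in the first $(n-1)$-dimensional variable ($\mathbf u$ or $\mathbf x$), and $\mathcal F$ the $2(n-1)$-dimensional Fourier transform in both variables, with the convention $\int e^{-i x\cdot\xi}g(x)\,dx$ (no normalizing factor). *)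

theory Defs
  imports "HOL-Analysis.Analysis"
begin

definition partial_deriv ::
    "'a::euclidean_space \<Rightarrow> ('a \<Rightarrow> complex) \<Rightarrow> 'a \<Rightarrow> complex" where
  "partial_deriv b f x = frechet_derivative f (at x) b"

(* A multi-index is given as a list of basis vectors, in order of differentiation
   from the right; the empty list gives the function itself. *)
definition iter_partial ::
    "'a::euclidean_space list \<Rightarrow> ('a \<Rightarrow> complex) \<Rightarrow> 'a \<Rightarrow> complex" where
  "iter_partial bs f = foldr partial_deriv bs f"

(* The differentiability condition for all lists makes the total functions
   partial_deriv and iter_partial genuine derivatives, and f infinitely
   differentiable. *)
definition schwartz :: "('a::euclidean_space \<Rightarrow> complex) set" where
  "schwartz = {f. \<forall>bs. set bs \<subseteq> Basis \<longrightarrow>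
      iter_partial bs f differentiable_on UNIV \<and>
      (\<forall>k::nat. bounded (range (\<lambda>x. norm x ^ k * norm (iter_partial bs f x))))}"

definition schwartz_r :: "((real ^ 'n) \<times> (real ^ 'n) \<Rightarrow> complex) set" where
  "schwartz_r = {f \<in> schwartz.
      \<forall>x y U. orthogonal_transformation U \<longrightarrow> f (x, y) = f (x, U y)}"

definition cone_transform ::
    "((real ^ 'n) \<times> (real ^ 'n) \<Rightarrow> complex) \<Rightarrow> (real ^ 'n) \<times> (real ^ 'n) \<Rightarrow> complex" where
  "cone_transform f = (\<lambda>(u, v). LINT y|lborel. f (u + norm v *\<^sub>R y, y))"

definition fourier :: "('a::euclidean_space \<Rightarrow> complex) \<Rightarrow> 'a \<Rightarrow> complex" where
  "fourier g \<xi> = (LINT x|lborel. exp (- \<i> * complex_of_real (x \<bullet> \<xi>)) * g x)"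

definition fourier1 ::
    "((real ^ 'n) \<times> (real ^ 'n) \<Rightarrow> complex) \<Rightarrow> (real ^ 'n) \<times> (real ^ 'n) \<Rightarrow> complex" where
  "fourier1 g = (\<lambda>(\<xi>, v). fourier (\<lambda>u. g (u, v)) \<xi>)"

end

theory Submission
  imports Defs "HOL-Probability.Sinc_Integral"
begin

text \<open>
  Substituting \<open>x = u + |v| y\<close> in the double integral defining the left-hand side yields the Fourier
  transform of \<open>f\<close> at \<open>(\<xi>, -|v| \<xi>)\<close>; the vectors \<open>-|v| \<xi>\<close>, \<open>|v| \<xi>\<close> and \<open>|\<xi>| v\<close> have the same
  length, hence lie in one orbit of the orthogonal group, and the Fourier transform inherits the
  rotational symmetry of \<open>f\<close> in the second variable.
\<close>

subsection \<open>Orthogonal invariance of Lebesgue measure\<close>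

lemma nn_integral_lborel_translation:
  fixes g :: "'a::euclidean_space \<Rightarrow> ennreal"
  assumes [measurable]: "g \<in> borel_measurable borel"
  shows "(\<integral>\<^sup>+x. g (c + x) \<partial>lborel) = (\<integral>\<^sup>+x. g x \<partial>lborel)"
  by (subst (2) lborel_distr_plus[of c, symmetric]) (simp add: nn_integral_distr)

lemma integral_lborel_translation:
  fixes g :: "'a::euclidean_space \<Rightarrow> 'b::{banach, second_countable_topology}"
  assumes [measurable]: "g \<in> borel_measurable borel"
  shows "(LINT x|lborel. g (c + x)) = (LINT x|lborel. g x)"
  by (subst (2) lborel_distr_plus[of c, symmetric]) (simp add: integral_distr)

lemma orthogonal_transformation_measurable:
  fixes U :: "'a::euclidean_space \<Rightarrow> 'a"
  assumes "orthogonal_transformation U"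
  shows "U \<in> borel_measurable borel"
  using assms
  by (intro borel_measurable_continuous_onI linear_continuous_on linear_conv_bounded_linear[THEN iffD1]
      orthogonal_transformation_linear)

text \<open>
  The proof of uniqueness of Haar measure: for the unit ball \<open>B\<close>, evaluate
  \<open>\<integral>\<integral> 1\<^sub>A(U x) 1\<^sub>B(U x - y) dy dx\<close> in both orders and cancel the measure of \<open>B\<close>. (The library's
  \<open>measure_orthogonal_image\<close> requires a well-ordered index type.)
\<close>
lemma lborel_distr_orthogonal:
  fixes U :: "'a::euclidean_space \<Rightarrow> 'a"
  assumes U: "orthogonal_transformation U"
  shows "distr lborel borel U = lborel"
proof (rule measure_eqI)
  fix A assume "A \<in> sets (distr lborel borel U)"
  then have A[measurable]: "A \<in> sets borel" by simp
  have [measurable]: "U \<in> borel_measurable borel"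
    by (rule orthogonal_transformation_measurable[OF U])
  define B :: "'a set" where "B = ball 0 1"
  have [measurable]: "B \<in> sets borel" by (simp add: B_def)
  have indB: "indicator B (U x) = (indicator B x :: ennreal)" for x
    by (simp add: B_def indicator_def orthogonal_transformation_norm[OF U])
  \<comment> \<open>Symmetry of the ball puts the integrand over \<open>y\<close> into the form
    \<open>- U x + y\<close> that translation invariance handles.\<close>
  have indB': "indicator B (x - y) = (indicator B (y - x) :: ennreal)" for x y
    by (simp add: B_def indicator_def norm_minus_commute)
  define V where "V = inv U"
  have UV: "U (V y) = y" for y
    unfolding V_def using orthogonal_transformation_surj[OF U] by (rule surj_f_inv_f)
  have Uadd: "U (x + y) = U x + U y" for x y
    using orthogonal_transformation_linear[OF U] by (rule linear_add)
  let ?I = "\<integral>\<^sup>+x. \<integral>\<^sup>+y. indicator A (U x) * indicator B (U x - y) \<partial>lborel \<partial>lborel"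
  have "?I = (\<integral>\<^sup>+x. indicator A (U x) * (\<integral>\<^sup>+y. indicator B (- U x + y) \<partial>lborel) \<partial>lborel)"
    by (simp add: nn_integral_cmult indB'[of "U _"])
  also have "\<dots> = (\<integral>\<^sup>+x. indicator A (U x) * emeasure lborel B \<partial>lborel)"
    by (subst nn_integral_lborel_translation) simp_all
  also have "\<dots> = (\<integral>\<^sup>+x. indicator A (U x) \<partial>lborel) * emeasure lborel B"
    by (simp add: nn_integral_multc)
  also have "(\<integral>\<^sup>+x. indicator A (U x) \<partial>lborel) = (\<integral>\<^sup>+x. indicator A x \<partial>distr lborel borel U)"
    by (rule nn_integral_distr[symmetric]) simp_all
  finally have 1: "?I = emeasure (distr lborel borel U) A * emeasure lborel B"
    by simp
  have "?I = (\<integral>\<^sup>+y. \<integral>\<^sup>+x. indicator A (U x) * indicator B (U x - y) \<partial>lborel \<partial>lborel)"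
    by (rule lborel_pair.Fubini') measurable
  \<comment> \<open>Shifting \<open>x\<close> by \<open>V y\<close> turns \<open>U x - y\<close>
    into \<open>U x\<close>, and the ball does not distinguish \<open>U x\<close> from
    \<open>x\<close>. Thus \<open>U\<close> survives only in the argument of \<open>A\<close>, where
    after another exchange \<open>U x\<close> is a mere translation of \<open>y\<close>.\<close>
  also have "\<dots> = (\<integral>\<^sup>+y. \<integral>\<^sup>+x. indicator A (U (V y + x)) * indicator B (U (V y + x) - y) \<partial>lborel \<partial>lborel)"
    by (subst nn_integral_lborel_translation) simp_all
  also have "\<dots> = (\<integral>\<^sup>+y. \<integral>\<^sup>+x. indicator A (U x + y) * indicator B x \<partial>lborel \<partial>lborel)"
    by (simp add: Uadd UV indB add.commute)
  also have "\<dots> = (\<integral>\<^sup>+x. \<integral>\<^sup>+y. indicator A (U x + y) * indicator B x \<partial>lborel \<partial>lborel)"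
    by (rule lborel_pair.Fubini') measurable
  also have "\<dots> = (\<integral>\<^sup>+x. (\<integral>\<^sup>+y. indicator A (U x + y) \<partial>lborel) * indicator B x \<partial>lborel)"
    by (simp add: nn_integral_multc)
  also have "\<dots> = (\<integral>\<^sup>+x. emeasure lborel A * indicator B x \<partial>lborel)"
    by (subst nn_integral_lborel_translation) simp_all
  also have "\<dots> = emeasure lborel A * emeasure lborel B"
    by (simp add: nn_integral_cmult)
  finally have 2: "?I = emeasure lborel A * emeasure lborel B" .
  \<comment> \<open>Cancellation in \<open>ennreal\<close> requires a factor that is neither 0 nor
    infinite.\<close>
  have "emeasure lborel B \<noteq> 0"
  proof
    assume "emeasure lborel B = 0"
    then have "negligible B"
      by (intro negligible_iff_null_sets[THEN iffD2] null_sets_completionI null_setsI) simp_all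
    then show False
      using open_not_negligible[of B] by (simp add: B_def)
  qed
  moreover have "emeasure lborel B \<noteq> \<infinity>"
    using emeasure_bounded_finite[of B] by (simp add: B_def)
  ultimately show "emeasure (distr lborel borel U) A = emeasure lborel A"
    using 1 2 by (metis ennreal_mult_cancel_left infinity_ennreal_def mult.commute)
qed simp

text \<open>The substitution of \<open>T z\<close> for \<open>z\<close> preserves Lebesgue measure,
  the inner product in the phase and, by assumption, \<open>f\<close>.\<close>

lemma fourier_orthogonal:
  fixes f :: "'a::euclidean_space \<Rightarrow> complex"
  assumes T: "orthogonal_transformation T" and [measurable]: "f \<in> borel_measurable borel"
    and f: "\<And>z. f (T z) = f z"
  shows "fourier f (T w) = fourier f w"
proof -
  have [measurable]: "T \<in> borel_measurable borel"
    by (rule orthogonal_transformation_measurable[OF T])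
  have "T z \<bullet> T w = z \<bullet> w" for z
    using T by (simp add: orthogonal_transformation_def)
  moreover have "fourier f (T w) = (LINT z|distr lborel borel T. exp (- \<i> * complex_of_real (z \<bullet> T w)) * f z)"
    by (simp add: fourier_def lborel_distr_orthogonal[OF T])
  ultimately show ?thesis
    by (simp add: fourier_def integral_distr f)
qed

subsection \<open>Integrability of rapidly decreasing functions\<close>

text \<open>This is the majorant for rapidly decreasing functions. Its product form matches
  \<open>lborel_eq\<close>, Lebesgue measure as the image of a product of one-dimensional ones, so
  integrability reduces to that of the derivative of arctan.\<close>

lemma integrable_lborel_prod_inverse_square:
  "integrable lborel (\<lambda>x::'a::euclidean_space. \<Prod>b\<in>Basis. inverse (1 + (x \<bullet> b)\<^sup>2))"
proof -
  interpret product_sigma_finite "\<lambda>_::'a. lborel :: real measure" ..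
  have 1: "integrable lborel (\<lambda>x::real. inverse (1 + x\<^sup>2))"
    using integrable_inverse_1_plus_square by (simp add: set_integrable_def)
  have "integrable (\<Pi>\<^sub>M b\<in>(Basis::'a set). lborel) (\<lambda>x. \<Prod>b\<in>Basis. inverse (1 + (x b :: real)\<^sup>2))"
    by (rule product_integrable_prod[where f = "\<lambda>_ x. inverse (1 + x\<^sup>2)"]) (simp_all add: 1)
  then show ?thesis
    by (subst lborel_eq) (subst integrable_distr_eq, simp_all)
qed

lemma prod_1_plus_square_le:
  fixes x :: "'a::euclidean_space"
  shows "(\<Prod>b\<in>Basis. 1 + (x \<bullet> b)\<^sup>2) \<le> 2 ^ DIM('a) * (1 + norm x ^ (2 * DIM('a)))"
proof -
  have "(\<Prod>b\<in>Basis. 1 + (x \<bullet> b)\<^sup>2) \<le> (\<Prod>b\<in>(Basis::'a set). 1 + (norm x)\<^sup>2)"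
    by (intro prod_mono) (auto simp: abs_le_square_iff[symmetric] Basis_le_norm)
  also have "\<dots> = (1 + (norm x)\<^sup>2) ^ DIM('a)"
    by simp
  \<comment> \<open>The estimate \<open>1 + t \<le> 2 * max 1 t\<close> is used because a power of a
    maximum is a maximum of powers, hence at most their sum.\<close>
  also have "\<dots> \<le> (2 * max 1 ((norm x)\<^sup>2)) ^ DIM('a)"
    by (intro power_mono) auto
  also have "\<dots> = 2 ^ DIM('a) * max 1 ((norm x)\<^sup>2) ^ DIM('a)"
    by (rule power_mult_distrib)
  also have "max 1 ((norm x)\<^sup>2) ^ DIM('a) \<le> 1 + norm x ^ (2 * DIM('a))"
    by (simp add: max_def power_mult)
  finally show ?thesis by simp
qed

lemma integrable_rapid_decrease:
  fixes g :: "'a::euclidean_space \<Rightarrow> complex"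
  assumes g: "g \<in> borel_measurable borel"
    and dec: "\<And>k::nat. bounded (range (\<lambda>x. norm x ^ k * norm (g x)))"
  shows "integrable lborel g"
proof -
  have "\<exists>C. \<forall>x. norm x ^ k * norm (g x) \<le> C" for k
    using dec[of k] by (force simp: bounded_iff)
  then obtain C where C: "\<And>k x. norm x ^ k * norm (g x) \<le> C k" by metis
  \<comment> \<open>The two terms of \<open>prod_1_plus_square_le\<close>, multiplied by
    \<open>norm (g x)\<close>, are the decay bounds of orders 0 and
    \<open>2 * DIM('a)\<close>.\<close>
  define K where "K = 2 ^ DIM('a) * (C 0 + C (2 * DIM('a)))"
  let ?P = "\<lambda>x::'a. \<Prod>b\<in>Basis. 1 + (x \<bullet> b)\<^sup>2"
  have "norm (g x) \<le> K * (\<Prod>b\<in>Basis. inverse (1 + (x \<bullet> b)\<^sup>2))" for x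
  proof -
    have "?P x > 0" by (intro prod_pos) (auto intro: add_pos_nonneg)
    have "?P x * norm (g x) \<le> 2 ^ DIM('a) * (1 + norm x ^ (2 * DIM('a))) * norm (g x)"
      by (intro mult_right_mono prod_1_plus_square_le) simp
    also have "\<dots> = 2 ^ DIM('a) * (norm x ^ 0 * norm (g x) + norm x ^ (2 * DIM('a)) * norm (g x))"
      by (simp add: algebra_simps)
    also have "\<dots> \<le> K"
      unfolding K_def by (intro mult_left_mono add_mono C) simp
    finally have "norm (g x) \<le> K / ?P x"
      using \<open>?P x > 0\<close> by (simp add: pos_le_divide_eq mult.commute)
    also have "\<dots> = K * (\<Prod>b\<in>Basis. inverse (1 + (x \<bullet> b)\<^sup>2))"
      unfolding divide_inverse prod_inversef[symmetric] by (simp add: o_def)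
    finally show ?thesis .
  qed
  moreover have "K * (\<Prod>b\<in>Basis. inverse (1 + (x \<bullet> b)\<^sup>2)) \<le> norm (K * (\<Prod>b\<in>Basis. inverse (1 + (x \<bullet> b)\<^sup>2)))" for x :: 'a
    by simp
  ultimately show ?thesis
    using g
    by (intro Bochner_Integration.integrable_bound[OF integrable_mult_right[OF integrable_lborel_prod_inverse_square, of K]])
      (auto intro!: AE_I2 intro: order_trans)
qed

lemma rapid_decrease_compose:
  fixes g :: "'b::real_normed_vector \<Rightarrow> complex" and L :: "'a::real_normed_vector \<Rightarrow> 'b"
  assumes dec: "\<And>k::nat. bounded (range (\<lambda>x. norm x ^ k * norm (g x)))"
    and L: "\<And>x. norm x \<le> K * norm (L x)"
  shows "bounded (range (\<lambda>x. norm x ^ k * norm (g (L x))))"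
proof -
  obtain C where C: "\<And>x. norm x ^ k * norm (g x) \<le> C"
    using dec[of k] by (force simp: bounded_iff)
  have "norm x ^ k * norm (g (L x)) \<le> \<bar>K\<bar> ^ k * C" for x
  proof -
    \<comment> \<open>The sign of \<open>K\<close> is not prescribed; the absolute value makes it
      possible to raise the inequality to the power \<open>k\<close>.\<close>
    have "norm x \<le> \<bar>K\<bar> * norm (L x)"
      using L[of x] by (meson abs_ge_self mult_right_mono norm_ge_zero order_trans)
    then have "norm x ^ k \<le> \<bar>K\<bar> ^ k * norm (L x) ^ k"
      by (metis norm_ge_zero power_mono power_mult_distrib)
    then have "norm x ^ k * norm (g (L x)) \<le> \<bar>K\<bar> ^ k * norm (L x) ^ k * norm (g (L x))"
      by (intro mult_right_mono) simp_all
    also have "\<dots> \<le> \<bar>K\<bar> ^ k * C"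
      using C[of "L x"] by (simp add: mult.assoc mult_left_mono)
    finally show ?thesis .
  qed
  then show ?thesis
    by (intro boundedI[of _ "\<bar>K\<bar> ^ k * C"]) auto
qed

text \<open>The shear is undone by subtracting \<open>c *\<^sub>R snd z\<close>: the sheared first
  component contributes 1 to the constant, the second component \<open>1 + \<bar>c\<bar>\<close>.
  Hence rapid decrease survives composition with the shear.\<close>

lemma norm_shear_ge:
  fixes z :: "'a::real_normed_vector \<times> 'a"
  shows "norm z \<le> (2 + \<bar>c\<bar>) * norm (fst z + c *\<^sub>R snd z, snd z)"
proof -
  let ?w = "(fst z + c *\<^sub>R snd z, snd z)"
  have 1: "norm (fst z + c *\<^sub>R snd z) \<le> norm ?w" and 2: "norm (snd z) \<le> norm ?w"
    using norm_fst_le[of "fst ?w" "snd ?w"] norm_snd_le[of "snd ?w" "fst ?w"] by simp_all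
  have "norm z \<le> norm (fst z) + norm (snd z)"
    using norm_Pair_le[of "fst z" "snd z"] by simp
  also have "norm (fst z) \<le> norm (fst z + c *\<^sub>R snd z) + \<bar>c\<bar> * norm (snd z)"
    using norm_triangle_ineq4[of "fst z + c *\<^sub>R snd z" "c *\<^sub>R snd z"] by simp
  also have "norm (fst z + c *\<^sub>R snd z) + \<bar>c\<bar> * norm (snd z) + norm (snd z)
      \<le> norm ?w + \<bar>c\<bar> * norm ?w + norm ?w"
    using 1 2 by (intro add_mono mult_left_mono) simp_all
  finally show ?thesis by (simp add: algebra_simps)
qed

subsection \<open>The projection-slice identity\<close>

lemma integrable_exp_mult:
  fixes g :: "'a \<Rightarrow> complex"
  assumes "integrable M g" and [measurable]: "h \<in> borel_measurable M"
  shows "integrable M (\<lambda>x. exp (- \<i> * complex_of_real (h x)) * g x)"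
proof -
  have [measurable]: "g \<in> borel_measurable M"
    using assms(1) by (rule borel_measurable_integrable)
  show ?thesis
    using assms(1) by (rule Bochner_Integration.integrable_bound) (simp_all add: norm_mult)
qed

lemma fourier1_cone_transform:
  fixes f :: "(real ^ 'n) \<times> (real ^ 'n) \<Rightarrow> complex"
  assumes f[measurable]: "f \<in> borel_measurable borel"
    and dec: "\<And>k::nat. bounded (range (\<lambda>x. norm x ^ k * norm (f x)))"
  shows "fourier1 (cone_transform f) (\<xi>, v) = fourier f (\<xi>, - (norm v *\<^sub>R \<xi>))"
proof -
  define c where "c = norm v"
  define e where "e = (\<lambda>x. exp (- \<i> * complex_of_real x))"
  have [measurable]: "e \<in> borel_measurable borel"
    unfolding e_def by measurable
  have [measurable]: "f \<in> borel_measurable (borel \<Otimes>\<^sub>M borel)"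
    by (simp add: borel_prod)
  \<comment> \<open>Joint integrability of the sheared function is what Fubini's theorem needs
    below.\<close>
  have "integrable lborel (\<lambda>z. f (fst z + c *\<^sub>R snd z, snd z))"
    by (intro integrable_rapid_decrease rapid_decrease_compose[OF dec norm_shear_ge])
      (simp add: borel_prod[symmetric])
  from integrable_exp_mult[OF this, of "\<lambda>z. fst z \<bullet> \<xi>"]
  have "integrable lborel (\<lambda>z. e (fst z \<bullet> \<xi>) * f (fst z + c *\<^sub>R snd z, snd z))"
    unfolding e_def by (simp add: borel_prod[symmetric])
  then have int1: "integrable (lborel \<Otimes>\<^sub>M lborel) (\<lambda>(u, y). e (u \<bullet> \<xi>) * f (u + c *\<^sub>R y, y))"
    by (simp add: lborel_prod case_prod_unfold)
  have "integrable lborel (\<lambda>z. e (z \<bullet> (\<xi>, - (c *\<^sub>R \<xi>))) * f z)"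
    unfolding e_def by (intro integrable_exp_mult integrable_rapid_decrease f dec) simp
  then have int2: "integrable (lborel \<Otimes>\<^sub>M lborel) (\<lambda>(x, y). e ((x, y) \<bullet> (\<xi>, - (c *\<^sub>R \<xi>))) * f (x, y))"
    by (simp only: lborel_prod case_prod_unfold prod.collapse)
  have "fourier1 (cone_transform f) (\<xi>, v) = (LINT u|lborel. e (u \<bullet> \<xi>) * (LINT y|lborel. f (u + c *\<^sub>R y, y)))"
    by (simp add: fourier1_def cone_transform_def fourier_def e_def c_def)
  \<comment> \<open>No integrability of the slices has to be checked: the exponential never
    vanishes, so for a slice that is not integrable both inner integrals take the default value
    0.\<close>
  also have "\<dots> = (LINT u|lborel. LINT y|lborel. e (u \<bullet> \<xi>) * f (u + c *\<^sub>R y, y))"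
    by simp
  also have "\<dots> = (LINT y|lborel. LINT u|lborel. e (u \<bullet> \<xi>) * f (u + c *\<^sub>R y, y))"
    by (rule lborel_pair.Fubini_integral[OF int1, symmetric])
  also have "\<dots> = (LINT y|lborel. LINT x|lborel. e ((x, y) \<bullet> (\<xi>, - (c *\<^sub>R \<xi>))) * f (x, y))"
  proof (rule Bochner_Integration.integral_cong[OF refl])
    fix y
    \<comment> \<open>With \<open>x = c *\<^sub>R y + u\<close> the phase
      \<open>u \<bullet> \<xi>\<close> equals
      \<open>x \<bullet> \<xi> - c * (y \<bullet> \<xi>)\<close>, which is where the minus sign in
      the second frequency originates.\<close>
    have "(LINT u|lborel. e (u \<bullet> \<xi>) * f (u + c *\<^sub>R y, y)) =
        (LINT u|lborel. e ((c *\<^sub>R y + u, y) \<bullet> (\<xi>, - (c *\<^sub>R \<xi>))) * f (c *\<^sub>R y + u, y))"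
      by (simp add: inner_add_left add.commute)
    also have "\<dots> = (LINT x|lborel. e ((x, y) \<bullet> (\<xi>, - (c *\<^sub>R \<xi>))) * f (x, y))"
      by (rule integral_lborel_translation[where c = "c *\<^sub>R y"]) simp
    finally show "(LINT u|lborel. e (u \<bullet> \<xi>) * f (u + c *\<^sub>R y, y)) =
        (LINT x|lborel. e ((x, y) \<bullet> (\<xi>, - (c *\<^sub>R \<xi>))) * f (x, y))" .
  qed
  also have "\<dots> = (\<integral>(x, y). e ((x, y) \<bullet> (\<xi>, - (c *\<^sub>R \<xi>))) * f (x, y) \<partial>(lborel \<Otimes>\<^sub>M lborel))"
    by (rule lborel_pair.integral_snd[OF int2])
  also have "\<dots> = fourier f (\<xi>, - (c *\<^sub>R \<xi>))"
    by (simp only: lborel_prod case_prod_unfold prod.collapse fourier_def e_def)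
  finally show ?thesis by (simp add: c_def)
qed

section \<open>Schwartz functions and rotations of the second variable\<close>

lemma schwartz_continuous:
  assumes "f \<in> schwartz"
  shows "continuous_on UNIV f"
  using assms unfolding schwartz_def iter_partial_def
  \<comment> \<open>The empty multi-index stands for \<open>f\<close> itself.\<close>
  by (auto dest!: spec[of _ "[]"] intro: differentiable_imp_continuous_on)

lemma schwartz_rapid_decrease:
  assumes "f \<in> schwartz"
  shows "bounded (range (\<lambda>x. norm x ^ k * norm (f x)))"
  using assms unfolding schwartz_def iter_partial_def
  by (auto dest!: spec[of _ "[]"])

lemma fourier_schwartz_r_cong_norm:
  fixes f :: "(real ^ 'n) \<times> (real ^ 'n) \<Rightarrow> complex"
  assumes f: "f \<in> schwartz_r" and "norm \<eta> = norm \<zeta>"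
  shows "fourier f (\<xi>, \<eta>) = fourier f (\<xi>, \<zeta>)"
proof -
  obtain U where U: "orthogonal_transformation U" and \<zeta>: "U \<eta> = \<zeta>"
    using orthogonal_transformation_exists[OF assms(2)] by blast
  \<comment> \<open>Letting \<open>U\<close> act on the second factor alone gives an orthogonal map
    of the product space that preserves \<open>f\<close> and keeps \<open>\<xi>\<close>
    fixed.\<close>
  define T where "T = (\<lambda>z::(real ^ 'n) \<times> (real ^ 'n). (fst z, U (snd z)))"
  have "orthogonal_transformation T"
    using U by (auto simp: orthogonal_transformation_def T_def linear_iff inner_prod_def)
  moreover have "f \<in> borel_measurable borel"
    using f unfolding schwartz_r_def by (blast intro: borel_measurable_continuous_onI schwartz_continuous)
  moreover have "f (T z) = f z" for z
  proof -
    have "f (fst z, snd z) = f (fst z, U (snd z))"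
      using f U unfolding schwartz_r_def by blast
    then show ?thesis by (simp add: T_def)
  qed
  ultimately have "fourier f (T (\<xi>, \<eta>)) = fourier f (\<xi>, \<eta>)"
    by (rule fourier_orthogonal)
  then show ?thesis by (simp add: T_def \<zeta>)
qed

theorem theorem1:
  fixes f :: "(real ^ 'n) \<times> (real ^ 'n) \<Rightarrow> complex"
  assumes "f \<in> schwartz_r"
  shows "\<forall>\<xi> v. fourier1 (cone_transform f) (\<xi>, v) = fourier f (\<xi>, norm v *\<^sub>R \<xi>) \<and>
               fourier f (\<xi>, norm v *\<^sub>R \<xi>) = fourier f (\<xi>, norm \<xi> *\<^sub>R v)"
proof (intro allI conjI)
  fix \<xi> v :: "real ^ 'n"
  have f: "f \<in> schwartz" using assms unfolding schwartz_r_def by blast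
  have "fourier1 (cone_transform f) (\<xi>, v) = fourier f (\<xi>, - (norm v *\<^sub>R \<xi>))"
    by (intro fourier1_cone_transform borel_measurable_continuous_onI schwartz_continuous
        schwartz_rapid_decrease f)
  also have "\<dots> = fourier f (\<xi>, norm v *\<^sub>R \<xi>)"
    by (rule fourier_schwartz_r_cong_norm[OF assms]) simp
  finally show "fourier1 (cone_transform f) (\<xi>, v) = fourier f (\<xi>, norm v *\<^sub>R \<xi>)" .
  show "fourier f (\<xi>, norm v *\<^sub>R \<xi>) = fourier f (\<xi>, norm \<xi> *\<^sub>R v)"
    by (rule fourier_schwartz_r_cong_norm[OF assms]) simp
qed

end
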